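(* If $G$ is a connected bridge-less chordal graph, then $rc(G) \leq 3 \cdot rad(G)$. Moreover, there exists a connected bridge-less chordal graph $G$ with $rc(G) = 3 \cdot rad(G)$.
   Context: A bridge of a connected graph is an edge whose removal disconnects it; a bridge-less graph has no bridges. A graph is chordal if it has no induced cycle of length greater than $3$. $rad(G)=\min_v \max_x d(v,x)$ is the radius. An edge-coloured graph is rainbow connected if every pair of vertices is joined by a path no two of whose edges have the same colour; $rc(G)$ is the minimum number of colours in an edge colouring making the connected graph $G$ rainbow connected. *)

theory Defs imports Main begin

definition simple_graph :: "'a set \<Rightarrow> 'a set set \<Rightarrow> bool" where
  "simple_graph V E \<longleftrightarrow> finite V \<and> (\<forall>e\<in>E. e \<subseteq> V \<and> card e = 2)"

fun path_edges :: "'a list \<Rightarrow> 'a set list" where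
  "path_edges (x # y # xs) = {x, y} # path_edges (y # xs)"
| "path_edges _ = []"

text \<open>A path is given by its list of vertices; the one-vertex list is the path of length zero.\<close>

definition is_path :: "'a set \<Rightarrow> 'a set set \<Rightarrow> 'a \<Rightarrow> 'a list \<Rightarrow> 'a \<Rightarrow> bool" where
  "is_path V E u p v \<longleftrightarrow> p \<noteq> [] \<and> hd p = u \<and> last p = v \<and> distinct p \<and>
     set p \<subseteq> V \<and> set (path_edges p) \<subseteq> E"

definition connected_graph :: "'a set \<Rightarrow> 'a set set \<Rightarrow> bool" where
  "connected_graph V E \<longleftrightarrow> V \<noteq> {} \<and> (\<forall>u\<in>V. \<forall>v\<in>V. \<exists>p. is_path V E u p v)"

definition bridge :: "'a set \<Rightarrow> 'a set set \<Rightarrow> 'a set \<Rightarrow> bool" where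
  "bridge V E e \<longleftrightarrow> e \<in> E \<and> \<not> connected_graph V (E - {e})"

definition bridgeless :: "'a set \<Rightarrow> 'a set set \<Rightarrow> bool" where
  "bridgeless V E \<longleftrightarrow> (\<forall>e. \<not> bridge V E e)"

text \<open>A cycle is given by the list of its vertices in cyclic order, so its length is the
  length of the list.\<close>

definition cycle_edges :: "'a list \<Rightarrow> 'a set set" where
  "cycle_edges vs = {{vs ! i, vs ! (Suc i mod length vs)} | i. i < length vs}"

definition is_cycle :: "'a set \<Rightarrow> 'a set set \<Rightarrow> 'a list \<Rightarrow> bool" where
  "is_cycle V E vs \<longleftrightarrow> 3 \<le> length vs \<and> distinct vs \<and> set vs \<subseteq> V \<and> cycle_edges vs \<subseteq> E"

definition induced_cycle :: "'a set \<Rightarrow> 'a set set \<Rightarrow> 'a list \<Rightarrow> bool" where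
  "induced_cycle V E vs \<longleftrightarrow> is_cycle V E vs \<and> {e \<in> E. e \<subseteq> set vs} = cycle_edges vs"

definition chordal :: "'a set \<Rightarrow> 'a set set \<Rightarrow> bool" where
  "chordal V E \<longleftrightarrow> \<not> (\<exists>vs. induced_cycle V E vs \<and> 3 < length vs)"

text \<open>Distance, radius and rainbow connection number are meaningful only for connected graphs;
  otherwise a least element below need not be attained.\<close>

definition graph_dist :: "'a set \<Rightarrow> 'a set set \<Rightarrow> 'a \<Rightarrow> 'a \<Rightarrow> nat" where
  "graph_dist V E u v = (LEAST n. \<exists>p. is_path V E u p v \<and> length (path_edges p) = n)"

definition rad :: "'a set \<Rightarrow> 'a set set \<Rightarrow> nat" where
  "rad V E = Min ((\<lambda>v. Max ((\<lambda>x. graph_dist V E v x) ` V)) ` V)"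

definition rainbow_connected :: "'a set \<Rightarrow> 'a set set \<Rightarrow> ('a set \<Rightarrow> nat) \<Rightarrow> bool" where
  "rainbow_connected V E c \<longleftrightarrow>
     (\<forall>u\<in>V. \<forall>v\<in>V. \<exists>p. is_path V E u p v \<and> distinct (map c (path_edges p)))"

definition rc :: "'a set \<Rightarrow> 'a set set \<Rightarrow> nat" where
  "rc V E = (LEAST k. \<exists>c. rainbow_connected V E c \<and> card (c ` E) = k)"

end

theory Submission imports Defs begin

text \<open>In a bridgeless chordal graph every edge lies in a triangle. Hence every vertex of the layer at
  distance \<open>k + 1\<close> from a central vertex has at least two neighbours in the ball of radius \<open>k + 1\<close>,
  and this suffices to extend a rainbow colouring of the ball of radius \<open>k\<close> to the ball of radius
  \<open>k + 1\<close> with three new colours. The bound is attained by three triangles sharing a vertex.\<close>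

subsection \<open>Paths\<close>

lemma path_edges_append: "path_edges (xs @ y # ys) = path_edges (xs @ [y]) @ path_edges (y # ys)"
proof (induction xs rule: path_edges.induct)
  case (1 x y' xs)
  then show ?case by simp
qed (cases ys; simp)+

lemma path_edges_Cons: "xs \<noteq> [] \<Longrightarrow> path_edges (x # xs) = {x, hd xs} # path_edges xs"
  by (cases xs) auto

lemma length_path_edges: "length (path_edges p) = length p - 1"
  by (induction p rule: path_edges.induct) auto

lemma path_edges_rev: "path_edges (rev p) = rev (path_edges p)"
proof (induction p rule: path_edges.induct)
  case (1 x y xs)
  have "path_edges (rev (x # y # xs)) = path_edges (rev xs @ y # [x])" by simp
  also have "\<dots> = path_edges (rev xs @ [y]) @ path_edges [y, x]" by (rule path_edges_append)
  also have "\<dots> = rev (path_edges (x # y # xs))" using 1 by (simp add: insert_commute)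
  finally show ?case .
qed auto

lemma set_path_edges_nth: "set (path_edges p) = {{p ! i, p ! Suc i} | i. Suc i < length p}"
proof (induction p rule: path_edges.induct)
  case (1 x y xs)
  show ?case
  proof (intro set_eqI iffI)
    fix e assume "e \<in> set (path_edges (x # y # xs))"
    then consider "e = {x, y}" | "e \<in> set (path_edges (y # xs))" by auto
    then show "e \<in> {{(x # y # xs) ! i, (x # y # xs) ! Suc i} | i. Suc i < length (x # y # xs)}"
    proof cases
      case 1
      then show ?thesis by (intro CollectI exI[of _ 0]) simp
    next
      case 2
      then obtain i where "Suc i < length (y # xs)" "e = {(y # xs) ! i, (y # xs) ! Suc i}"
        using 1 by auto
      then show ?thesis by (intro CollectI exI[of _ "Suc i"]) simp
    qed
  next
    fix e assume "e \<in> {{(x # y # xs) ! i, (x # y # xs) ! Suc i} | i. Suc i < length (x # y # xs)}"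
    then obtain i where "Suc i < length (x # y # xs)" "e = {(x # y # xs) ! i, (x # y # xs) ! Suc i}"
      by blast
    then show "e \<in> set (path_edges (x # y # xs))" using 1 by (cases i) auto
  qed
qed auto

lemma path_edges_subset: "e \<in> set (path_edges p) \<Longrightarrow> e \<subseteq> set p"
  by (induction p rule: path_edges.induct) auto

lemma is_path_single: "u \<in> V \<Longrightarrow> is_path V E u [u] u"
  by (simp add: is_path_def)

lemma is_path_rev: "is_path V E u p v \<Longrightarrow> is_path V E v (rev p) u"
  by (auto simp: is_path_def path_edges_rev hd_rev last_rev)

text \<open>A path may not revisit \<open>w\<close>: if \<open>w\<close> is off \<open>p\<close> it
  is prepended, otherwise the part of \<open>p\<close> from \<open>w\<close> onwards is taken.
  Either way the edges of \<open>q\<close>, hence its colours, are under control.\<close>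

lemma is_path_step:
  assumes p: "is_path V E u p v" and w: "w \<in> V" "{w, u} \<in> E"
  obtains q where "is_path V E w q v"
    "path_edges q = {w, u} # path_edges p \<or> (\<exists>es. path_edges p = es @ path_edges q)"
proof (cases "w \<in> set p")
  case False
  then have "is_path V E w (w # p) v" "path_edges (w # p) = {w, u} # path_edges p"
    using p w by (auto simp: is_path_def path_edges_Cons)
  then show ?thesis using that by blast
next
  case True
  then obtain ys zs where q: "p = ys @ w # zs" by (auto simp: in_set_conv_decomp)
  have "path_edges p = path_edges (ys @ [w]) @ path_edges (w # zs)"
    unfolding q by (rule path_edges_append)
  moreover from this have "is_path V E w (w # zs) v"
    using p q by (auto simp: is_path_def)
  ultimately show ?thesis using that by blast
qed

text \<open>The vertex set confines the path to a ball, and \<open>K\<close> bounds the colours it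
  may spend, so that colours outside \<open>K\<close> stay free for extending it.\<close>

definition rainbow_reach ::
  "'a set \<Rightarrow> 'a set set \<Rightarrow> ('a set \<Rightarrow> nat) \<Rightarrow> nat set \<Rightarrow> 'a \<Rightarrow> 'a \<Rightarrow> bool" where
  "rainbow_reach V E c K u v \<longleftrightarrow> (\<exists>p. is_path V E u p v \<and> distinct (map c (path_edges p)) \<and>
     c ` set (path_edges p) \<subseteq> K)"

lemma rainbow_reach_refl: "u \<in> V \<Longrightarrow> rainbow_reach V E c K u u"
  unfolding rainbow_reach_def by (rule exI[of _ "[u]"]) (simp add: is_path_def)

lemma rainbow_reach_sym: "rainbow_reach V E c K u v \<Longrightarrow> rainbow_reach V E c K v u"
  unfolding rainbow_reach_def
  by (metis is_path_rev path_edges_rev rev_map distinct_rev set_rev)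

text \<open>A path inside \<open>V\<close> uses only edges contained in \<open>V\<close>, so the
  colourings have to agree only there. This carries paths from one ball to the next.\<close>

lemma rainbow_reach_mono:
  assumes "rainbow_reach V E c K u v" "V \<subseteq> V'" "K \<subseteq> K'" "\<And>e. e \<in> E \<Longrightarrow> e \<subseteq> V \<Longrightarrow> c' e = c e"
  shows "rainbow_reach V' E c' K' u v"
proof -
  obtain p where p: "is_path V E u p v" "distinct (map c (path_edges p))"
    "c ` set (path_edges p) \<subseteq> K"
    using assms(1) unfolding rainbow_reach_def by blast
  have eq: "c' e = c e" if "e \<in> set (path_edges p)" for e
    using that p(1) path_edges_subset[OF that] assms(4) by (auto simp: is_path_def)
  then have "map c' (path_edges p) = map c (path_edges p)" by simp
  moreover have "c' ` set (path_edges p) \<subseteq> K'" using eq p(3) assms(3) by auto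
  moreover have "is_path V' E u p v" using p(1) assms(2) by (auto simp: is_path_def)
  ultimately show ?thesis unfolding rainbow_reach_def using p(2) by metis
qed

text \<open>A colour outside \<open>K\<close> cannot recur on the path from \<open>u\<close>. If
  \<open>w\<close> already lies on that path, the suffix starting at \<open>w\<close> inherits
  distinct colours.\<close>

lemma rainbow_reach_step:
  assumes "rainbow_reach V E c K u v" "w \<in> V" "{w, u} \<in> E" "c {w, u} \<notin> K"
  shows "rainbow_reach V E c (insert (c {w, u}) K) w v"
proof -
  obtain p where p: "is_path V E u p v" "distinct (map c (path_edges p))"
    "c ` set (path_edges p) \<subseteq> K"
    using assms(1) unfolding rainbow_reach_def by blast
  obtain q where q: "is_path V E w q v"
    "path_edges q = {w, u} # path_edges p \<or> (\<exists>es. path_edges p = es @ path_edges q)"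
    using is_path_step[OF p(1) assms(2,3)] by blast
  have "distinct (map c (path_edges q)) \<and> c ` set (path_edges q) \<subseteq> insert (c {w, u}) K"
    using q(2)
  proof (elim disjE exE)
    assume q': "path_edges q = {w, u} # path_edges p"
    have "c {w, u} \<notin> c ` set (path_edges p)" using p(3) assms(4) by blast
    then show ?thesis using p(2,3) unfolding q' by auto
  next
    fix es assume "path_edges p = es @ path_edges q"
    then show ?thesis using p(2,3) by auto
  qed
  then show ?thesis unfolding rainbow_reach_def using q(1) by blast
qed

subsection \<open>Edges and triangles\<close>

lemma cycle_edges_path:
  assumes "p \<noteq> []"
  shows "cycle_edges p = insert {last p, hd p} (set (path_edges p))"
proof -
  \<comment> \<open>The last index wraps around to \<open>0\<close> and gives the closing edge; the
    other indices give the edges of the path.\<close>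
  have "{{p ! i, p ! (Suc i mod length p)} | i. i < length p} =
    insert {p ! (length p - 1), p ! 0} {{p ! i, p ! Suc i} | i. Suc i < length p}" (is "?L = ?R")
  proof (intro set_eqI iffI)
    fix e assume "e \<in> ?L"
    then obtain i where i: "i < length p" "e = {p ! i, p ! (Suc i mod length p)}" by blast
    show "e \<in> ?R"
    proof (cases "Suc i < length p")
      case True
      then show ?thesis using i by auto
    next
      case False
      then have "i = length p - 1" "Suc i mod length p = 0" using i(1) by (auto simp: mod_if)
      then show ?thesis using i(2) by simp
    qed
  next
    fix e assume "e \<in> ?R"
    then consider "e = {p ! (length p - 1), p ! 0}"
      | i where "Suc i < length p" "e = {p ! i, p ! Suc i}" by blast
    then show "e \<in> ?L"
    proof cases
      case 1
      then show ?thesis using assms by (intro CollectI exI[of _ "length p - 1"]) simp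
    next
      case 2
      then show ?thesis by (intro CollectI exI[of _ i]) simp
    qed
  qed
  then show ?thesis
    using assms by (simp add: cycle_edges_def set_path_edges_nth last_conv_nth hd_conv_nth)
qed

text \<open>Otherwise close a shortest path around the edge to a cycle: a chord of it would shorten
  the path.\<close>

lemma edge_in_triangle:
  assumes simple: "simple_graph V E" and bl: "bridgeless V E" and ch: "chordal V E"
    and e: "{x, d} \<in> E"
  obtains w where "w \<noteq> x" "w \<noteq> d" "{x, w} \<in> E" "{d, w} \<in> E"
proof -
  let ?F = "E - {{x, d}}"
  have "card {x, d} = 2" and xV: "x \<in> V" "d \<in> V" using simple e by (auto simp: simple_graph_def)
  then have xd: "x \<noteq> d" by auto
  have "connected_graph V ?F" using bl e by (auto simp: bridgeless_def bridge_def)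
  then have "\<exists>p. is_path V ?F x p d" using xV by (auto simp: connected_graph_def)
  then obtain p where p: "is_path V ?F x p d"
    and min: "\<And>q. is_path V ?F x q d \<Longrightarrow> length p \<le> length q"
    using ex_has_least_nat[of "\<lambda>p. is_path V ?F x p d" _ length] by blast
  have pr: "p \<noteq> []" "hd p = x" "last p = d" "distinct p" "set p \<subseteq> V" "set (path_edges p) \<subseteq> ?F"
    using p by (auto simp: is_path_def)
  obtain p1 where p1: "p = x # p1" using pr(1,2) by (cases p) auto
  then obtain w p2 where "p1 = w # p2" using pr(3) xd by (cases p1) auto
  then have p2: "p = x # w # p2" using p1 by simp
  then have w: "{x, w} \<in> ?F" using pr(6) by simp
  then have "w \<noteq> d" by auto
  then obtain y p3 where p3: "p = x # w # y # p3" using pr(3) p2 by (cases p2) auto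
  \<comment> \<open>A longer shortest path would close with \<open>{x, d}\<close> to a cycle of
    length at least 4, which has a chord by chordality. With \<open>p3 = []\<close> the middle
    vertex \<open>w\<close> completes the triangle.\<close>
  have "p3 = []"
  proof (rule ccontr)
    assume "p3 \<noteq> []"
    then have len: "3 < length p" using p3 by (cases p3) auto
    have ce: "cycle_edges p = insert {x, d} (set (path_edges p))"
      using cycle_edges_path[OF pr(1)] pr(2,3) by (simp add: insert_commute)
    then have cyc: "is_cycle V E p" using pr(4-6) e len by (auto simp: is_cycle_def)
    moreover have "cycle_edges p \<subseteq> {e \<in> E. e \<subseteq> set p}"
      using cyc path_edges_subset pr(1-3) unfolding ce is_cycle_def
      by (auto dest: hd_in_set last_in_set)
    moreover have "\<not> induced_cycle V E p" using ch len by (auto simp: chordal_def)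
    then have "{e \<in> E. e \<subseteq> set p} \<noteq> cycle_edges p"
      using cyc by (simp only: induced_cycle_def simp_thms)
    ultimately have "\<not> {e \<in> E. e \<subseteq> set p} \<subseteq> cycle_edges p"
      by (metis (no_types) subset_antisym)
    then obtain f where f: "f \<in> E" "f \<subseteq> set p" "f \<notin> cycle_edges p"
      by (metis (mono_tags, lifting) mem_Collect_eq subsetI)
    have "card f = 2" using f(1) simple by (auto simp: simple_graph_def)
    then obtain a b where ab: "f = {a, b}" "a \<noteq> b" by (auto simp: card_2_iff)
    have False if fd: "p = us @ a # vs @ b # ws" "f = {a, b}" for a b us vs ws
    proof -
      have 1: "path_edges p = path_edges (us @ [a]) @ path_edges (a # vs @ b # ws)"
        unfolding fd by (rule path_edges_append)
      have 2: "path_edges (a # vs @ b # ws) = path_edges (a # vs @ [b]) @ path_edges (b # ws)"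
        using path_edges_append[of "a # vs" b ws] by simp
      have vs: "vs \<noteq> []"
      proof
        assume "vs = []"
        then have "f \<in> set (path_edges p)" using fd(2) 1 by simp
        then show False using f(3) ce by simp
      qed
      \<comment> \<open>The chord replaces the stretch through the nonempty \<open>vs\<close>, so
        \<open>?q\<close> is strictly shorter than \<open>p\<close>.\<close>
      let ?q = "us @ a # b # ws"
      have "path_edges ?q = path_edges (us @ [a]) @ {a, b} # path_edges (b # ws)"
        using path_edges_append[of us a "b # ws"] by simp
      \<comment> \<open>The chord is not the deleted edge, because \<open>{x, d}\<close> is the
        closing edge of the cycle.\<close>
      moreover have "{a, b} \<in> ?F" using f ce fd(2) by auto
      ultimately have "set (path_edges ?q) \<subseteq> ?F" using pr(6) 1 2 by auto
      moreover have "hd ?q = x" using pr(2) fd(1) by (cases us) auto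
      moreover have "last ?q = d" using pr(3) fd(1) by simp
      moreover have "distinct ?q" "set ?q \<subseteq> V" using pr(4,5) fd(1) by auto
      ultimately have "is_path V ?F x ?q d" by (simp add: is_path_def)
      then show False using min[of ?q] vs fd(1) by simp
    qed
    note short = this
    have "a \<in> set p" "b \<in> set p" using f(2) ab by auto
    obtain us rs where us: "p = us @ a # rs" using \<open>a \<in> set p\<close> by (auto simp: in_set_conv_decomp)
    \<comment> \<open>Either end of the chord may come first on the path; in the second case the
      shortcut is used with \<open>a\<close> and \<open>b\<close> exchanged.\<close>
    consider "b \<in> set rs" | "b \<in> set us" using \<open>b \<in> set p\<close> us ab(2) by auto
    then show False
    proof cases
      case 1
      then obtain vs ws where "rs = vs @ b # ws" by (auto simp: in_set_conv_decomp)
      then show ?thesis using short[of us a vs b ws] us ab(1) by simp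
    next
      case 2
      then obtain vs ws where "us = vs @ b # ws" by (auto simp: in_set_conv_decomp)
      then show ?thesis using short[of vs b ws a rs] us ab(1) by (simp add: insert_commute)
    qed
  qed
  then have "y = d" "{w, d} \<in> E" using pr(3,6) p3 by auto
  then show ?thesis using that[of w] w \<open>w \<noteq> d\<close> pr(4) p3 by (auto simp: insert_commute)
qed

subsection \<open>Colouring layer by layer\<close>

text \<open>If \<open>y\<close> had no neighbour in a maximal \<open>X\<close>, then
  \<open>insert y X\<close> would still be independent; so \<open>X\<close> also dominates
  \<open>W\<close>.\<close>

lemma maximal_independent_subset:
  assumes "finite W"
  obtains X where "X \<subseteq> W" "\<And>x y. x \<in> X \<Longrightarrow> y \<in> X \<Longrightarrow> x \<noteq> y \<Longrightarrow> {x, y} \<notin> E"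
    "\<And>y. y \<in> W \<Longrightarrow> y \<notin> X \<Longrightarrow> \<exists>x\<in>X. {y, x} \<in> E"
proof -
  let ?I = "{X. X \<subseteq> W \<and> (\<forall>x\<in>X. \<forall>y\<in>X. x \<noteq> y \<longrightarrow> {x, y} \<notin> E)}"
  have "finite ?I" "?I \<noteq> {}" using assms by auto
  then obtain X where X: "X \<in> ?I" and mx: "\<forall>Y\<in>?I. X \<subseteq> Y \<longrightarrow> X = Y"
    by (rule bexE[OF finite_has_maximal])
  have "\<exists>x\<in>X. {y, x} \<in> E" if y: "y \<in> W" "y \<notin> X" for y
  proof (rule ccontr)
    assume "\<not> ?thesis"
    then have "insert y X \<in> ?I" using X y by (auto simp: insert_commute)
    from bspec[OF mx this] show False using y by blast
  qed
  then show ?thesis using that X by blast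
qed

text \<open>Let \<open>X\<close> be a maximal independent set of the new vertices. Edges from \<open>X\<close> to \<open>D\<close> get colour \<open>n\<close>,
  those from the other new vertices to \<open>D\<close> get \<open>n + 1\<close>, and edges between new vertices get \<open>n + 2\<close>;
  a vertex with all its neighbours in \<open>D\<close> uses \<open>n\<close> for one of its edges and \<open>n + 1\<close> for the others.
  So every new vertex reaches \<open>D\<close> directly in colour \<open>n\<close> or \<open>n + 1\<close>, and in the other of these
  colours at worst after one edge of colour \<open>n + 2\<close>; two such exits of different kind fit
  together.\<close>

lemma rainbow_extend:
  assumes fin: "finite D'" and sub: "D \<subseteq> D'" and E2: "\<And>e. e \<in> E \<Longrightarrow> card e = 2"
    and dom: "\<And>x. x \<in> D' - D \<Longrightarrow> \<exists>d\<in>D. \<exists>w\<in>D'. {x, d} \<in> E \<and> {x, w} \<in> E \<and> w \<noteq> d"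
    and bd: "\<And>e. e \<in> E \<Longrightarrow> e \<subseteq> D \<Longrightarrow> c e < n"
    and rb: "\<And>u v. u \<in> D \<Longrightarrow> v \<in> D \<Longrightarrow> rainbow_reach D E c {..<n} u v"
  obtains c' where "\<And>e. e \<in> E \<Longrightarrow> e \<subseteq> D' \<Longrightarrow> c' e < n + 3"
    "\<And>u v. u \<in> D' \<Longrightarrow> v \<in> D' \<Longrightarrow> rainbow_reach D' E c' {..<n + 3} u v"
proof -
  define W where "W = D' - D"
  have "finite W" using fin by (simp add: W_def)
  then obtain X where X: "X \<subseteq> W"
      and ind: "\<And>x y. x \<in> X \<Longrightarrow> y \<in> X \<Longrightarrow> x \<noteq> y \<Longrightarrow> {x, y} \<notin> E"
      and dX: "\<And>y. y \<in> W \<Longrightarrow> y \<notin> X \<Longrightarrow> \<exists>x\<in>X. {y, x} \<in> E"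
    using maximal_independent_subset[of W E] by blast
  have "\<exists>f. \<forall>x\<in>W. f x \<in> D \<and> {x, f x} \<in> E"
    by (rule bchoice) (use dom in \<open>auto simp: W_def\<close>)
  then obtain f where f: "\<And>x. x \<in> W \<Longrightarrow> f x \<in> D" "\<And>x. x \<in> W \<Longrightarrow> {x, f x} \<in> E" by blast
  define iso where "iso x \<longleftrightarrow> (\<forall>y\<in>W. {x, y} \<notin> E)" for x
  \<comment> \<open>The definition is total: it also colours edges that leave \<open>D'\<close>,
    which no path inside \<open>D'\<close> traverses.\<close>
  define c' where "c' e = (if e \<subseteq> D then c e else if e \<inter> D = {} then n + 2
     else if \<exists>x\<in>X - D. \<exists>d\<in>D. e = {x, d} \<and> (iso x \<longrightarrow> d = f x) then n else n + 1)" for e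
  have c'b: "c' e < n + 3" if "e \<in> E" for e
    using bd[OF that] by (simp add: c'_def trans_less_add1)
  have XW: "x \<in> X \<Longrightarrow> x \<notin> D" "x \<in> W \<Longrightarrow> x \<in> D' \<and> x \<notin> D" for x using X by (auto simp: W_def)
  have cA: "c' {x, d} = n" if "x \<in> X" "d \<in> D" "iso x \<longrightarrow> d = f x" for x d
    using that XW(1)[OF that(1)] unfolding c'_def by auto
  have cB: "c' {x, d} = n + 1" if "x \<in> W" "d \<in> D" "x \<in> X \<longrightarrow> iso x \<and> d \<noteq> f x" for x d
    using that XW unfolding c'_def by (auto simp: doubleton_eq_iff)
  have cG: "c' {x, y} = n + 2" if "x \<in> W" "y \<in> W" for x y
    using that XW unfolding c'_def by auto
  have rbD: "rainbow_reach D' E c' {..<n} u v" if "u \<in> D" "v \<in> D" for u v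
    using rainbow_reach_mono[OF rb[OF that] sub] by (auto simp: c'_def)
  \<comment> \<open>\<open>m\<close> is the colour with which \<open>D\<close> is entered;
    \<open>exit2\<close> also allows a detour over one edge inside \<open>W\<close>, of colour
    \<open>n + 2\<close>.\<close>
  define exit where "exit m x \<longleftrightarrow> (\<exists>d\<in>D. {x, d} \<in> E \<and> c' {x, d} = m)" for m x
  define exit2 where "exit2 m x \<longleftrightarrow> exit m x \<or> (\<exists>y\<in>W. {x, y} \<in> E \<and> exit m y)" for m x
  have ex: "(exit n x \<or> exit (n + 1) x) \<and> exit2 n x \<and> exit2 (n + 1) x" if x: "x \<in> W" for x
  proof -
    have XA: "exit n y" if "y \<in> X" for y
      using cA[OF that f(1)] f[of y] that X unfolding exit_def by blast
    have YB: "exit (n + 1) y" if "y \<in> W" "y \<notin> X" for y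
      using cB[OF that(1) f(1)] f[of y] that unfolding exit_def by blast
    consider "x \<notin> X" | "x \<in> X" "iso x" | y where "x \<in> X" "y \<in> W" "{x, y} \<in> E"
      unfolding iso_def by blast
    then show ?thesis
    proof cases
      case 1
      then show ?thesis using YB[OF x] dX[OF x] XA X unfolding exit2_def by blast
    next
      case 2
      obtain d w where dw: "d \<in> D" "w \<in> D'" "{x, d} \<in> E" "{x, w} \<in> E" "w \<noteq> d"
        using dom x unfolding W_def by blast
      \<comment> \<open>Both neighbours from \<open>dom\<close> now lie in \<open>D\<close>; being
        distinct, one of them differs from \<open>f x\<close>, and its edge has colour
        \<open>n + 1\<close>.\<close>
      have "w \<in> D" using 2(2) dw unfolding iso_def W_def by blast
      then obtain d' where "d' \<in> D" "{x, d'} \<in> E" "d' \<noteq> f x" using dw by metis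
      then have "exit (n + 1) x" using cB[OF x] 2 unfolding exit_def by blast
      then show ?thesis using XA[OF 2(1)] unfolding exit2_def by blast
    next
      case 3
      \<comment> \<open>Independence puts \<open>y\<close> outside \<open>X\<close>, so
        \<open>y\<close> exits with \<open>n + 1\<close> while \<open>x\<close> itself exits with
        \<open>n\<close>.\<close>
      have "y \<noteq> x" using E2[OF 3(3)] by auto
      then have "y \<notin> X" using ind[of x y] 3 by blast
      then show ?thesis using XA[OF 3(1)] YB[OF 3(2)] 3 unfolding exit2_def by blast
    qed
  qed
  have r1: "rainbow_reach D' E c' (insert m {..<n}) x d"
    if a: "exit m x" "m \<ge> n" "x \<in> W" "d \<in> D" for m x d
  proof -
    obtain d' where d': "d' \<in> D" "{x, d'} \<in> E" "c' {x, d'} = m"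
      using a(1) unfolding exit_def by blast
    have "x \<in> D'" "c' {x, d'} \<notin> {..<n}" using XW(2)[OF a(3)] d'(3) a(2) by simp_all
    from rainbow_reach_step[OF rbD[OF d'(1) a(4)] this(1) d'(2) this(2)]
    show ?thesis by (simp only: d'(3))
  qed
  have r2: "rainbow_reach D' E c' (insert (n + 2) (insert m {..<n})) x d"
    if m: "exit2 m x" "m = n \<or> m = n + 1" and x: "x \<in> W" "d \<in> D" for m x d
  proof (cases "exit m x")
    case True
    have "n \<le> m" using m(2) by auto
    from rainbow_reach_mono[OF r1[OF True this x] subset_refl subset_insertI refl] show ?thesis .
  next
    case False
    then obtain y where y: "y \<in> W" "{x, y} \<in> E" "exit m y" using m unfolding exit2_def by blast
    have "n \<le> m" using m(2) by auto
    from r1[OF y(3) this y(1) x(2)] have "rainbow_reach D' E c' (insert m {..<n}) y d" .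
    moreover have c: "x \<in> D'" "c' {x, y} = n + 2"
      using XW(2)[OF x(1)] cG[OF x(1) y(1)] by simp_all
    moreover from c have "c' {x, y} \<notin> insert m {..<n}" using m(2) by auto
    ultimately show ?thesis using rainbow_reach_step[OF _ _ y(2)] by metis
  qed
  have mono: "rainbow_reach D' E c' {..<n + 3} u v"
    if "rainbow_reach D' E c' K u v" "K \<subseteq> {..<n + 3}" for K u v
    by (rule rainbow_reach_mono[OF that(1) subset_refl that(2) refl])
  have DW: "rainbow_reach D' E c' {..<n + 3} x d" if "x \<in> W" "d \<in> D" for x d
    by (rule mono[OF r2[of n]]) (use ex[OF that(1)] that in auto)
  have pair: "rainbow_reach D' E c' {..<n + 3} x y"
    if a: "exit m x" "exit2 m' y" "x \<in> W" "y \<in> W" "m = n \<and> m' = n + 1 \<or> m = n + 1 \<and> m' = n"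
    for m m' x y
  proof -
    obtain d where d: "d \<in> D" "{x, d} \<in> E" "c' {x, d} = m"
      using a(1) unfolding exit_def by blast
    have "m' = n \<or> m' = n + 1" using a(5) by blast
    \<comment> \<open>The route from \<open>d\<close> to \<open>y\<close> spends only
      \<open>n + 2\<close>, \<open>m'\<close> and colours below \<open>n\<close>, so
      \<open>m\<close> is still free for the edge \<open>{x, d}\<close>.\<close>
    then have r: "rainbow_reach D' E c' (insert (n + 2) (insert m' {..<n})) d y"
      by (intro rainbow_reach_sym[OF r2] a(2,4) d(1))
    have "x \<in> D'" "c' {x, d} \<notin> insert (n + 2) (insert m' {..<n})"
      using XW(2)[OF a(3)] a(5) d(3) by auto
    from mono[OF rainbow_reach_step[OF r this(1) d(2) this(2)]] show ?thesis
      using a(5) d(3) by auto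
  qed
  \<comment> \<open>Whichever of \<open>n\<close> and \<open>n + 1\<close> gives \<open>x\<close> a
    direct exit, \<open>y\<close> exits with the other one, possibly after a detour; so
    \<open>n + 2\<close> is spent at most once.\<close>
  have WW: "rainbow_reach D' E c' {..<n + 3} x y" if "x \<in> W" "y \<in> W" for x y
    using ex[OF that(1)] ex[OF that(2)] pair[of n x "n + 1" y] pair[of "n + 1" x n y] that by blast
  have "rainbow_reach D' E c' {..<n + 3} u v" if uv: "u \<in> D'" "v \<in> D'" for u v
  proof -
    consider "u \<in> D" "v \<in> D" | "u \<in> D" "v \<in> W" | "u \<in> W" "v \<in> D" | "u \<in> W" "v \<in> W"
      using uv W_def by blast
    then show ?thesis
    proof cases
      case 1
      then show ?thesis by (intro mono[OF rbD]) auto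
    next
      case 2
      then show ?thesis by (intro rainbow_reach_sym[OF DW])
    qed (intro DW WW; assumption)+
  qed
  then show ?thesis using that[of c'] c'b by blast
qed

text \<open>Recursion on the radius, rather than a bound on \<open>graph_dist\<close>, hands every
  new vertex a neighbour in the previous ball, as the induction over layers requires.\<close>

primrec ball :: "'a set \<Rightarrow> 'a set set \<Rightarrow> 'a \<Rightarrow> nat \<Rightarrow> 'a set" where
  "ball V E v 0 = {v}"
| "ball V E v (Suc k) = ball V E v k \<union> {x \<in> V. \<exists>d\<in>ball V E v k. {x, d} \<in> E}"

lemma ball_subset: "v \<in> V \<Longrightarrow> ball V E v k \<subseteq> V"
  by (induction k) auto

text \<open>Each edge raises the radius by one. Start vertex and radius vary in the induction,
  because the tail of the path starts in the next ball.\<close>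

lemma path_end_in_ball:
  assumes "u \<in> ball V E v k" "is_path V E u p x"
  shows "x \<in> ball V E v (k + length (path_edges p))"
  using assms
proof (induction p arbitrary: u k)
  case Nil
  then show ?case by (simp add: is_path_def)
next
  case (Cons a p)
  show ?case
  proof (cases p)
    case Nil
    then show ?thesis using Cons.prems by (auto simp: is_path_def)
  next
    case (Cons b q)
    then have "is_path V E b p x" "a = u" "{b, u} \<in> E" "b \<in> V"
      using Cons.prems by (auto simp: is_path_def insert_commute)
    then have "b \<in> ball V E v (Suc k)" using Cons.prems(1) by auto
    then show ?thesis using Cons.IH[OF _ \<open>is_path V E b p x\<close>] Cons by fastforce
  qed
qed

text \<open>Induction on the radius. The third vertex of a triangle over an edge into the smaller
  ball is adjacent to a vertex of that ball, so it lies in the larger ball and serves as the second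
  neighbour of the new vertex.\<close>

lemma rainbow_ball:
  assumes simple: "simple_graph V E"
    and tri: "\<And>x d. {x, d} \<in> E \<Longrightarrow> \<exists>w. w \<noteq> d \<and> {x, w} \<in> E \<and> {d, w} \<in> E"
    and v: "v \<in> V"
  shows "\<exists>c. (\<forall>e\<in>E. e \<subseteq> ball V E v k \<longrightarrow> c e < 3 * k) \<and>
    (\<forall>x\<in>ball V E v k. \<forall>y\<in>ball V E v k. rainbow_reach (ball V E v k) E c {..<3 * k} x y)"
proof (induction k)
  case 0
  have "\<not> e \<subseteq> {v}" if "e \<in> E" for e
  proof
    assume "e \<subseteq> {v}"
    then have "card e \<le> 1" using card_mono[of "{v}" e] by simp
    then show False using simple that by (auto simp: simple_graph_def)
  qed
  then show ?case by (auto intro: rainbow_reach_refl)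
next
  case (Suc k)
  let ?D = "ball V E v k" and ?D' = "ball V E v (Suc k)"
  obtain c where c: "\<forall>e\<in>E. e \<subseteq> ?D \<longrightarrow> c e < 3 * k"
    "\<forall>x\<in>?D. \<forall>y\<in>?D. rainbow_reach ?D E c {..<3 * k} x y"
    using Suc.IH by (elim exE conjE)
  have EV: "e \<subseteq> V" "card e = 2" if "e \<in> E" for e using simple that by (auto simp: simple_graph_def)
  have fin: "finite ?D'"
    using ball_subset[OF v] simple finite_subset by (metis simple_graph_def)
  have dom: "\<exists>d\<in>?D. \<exists>w\<in>?D'. {x, d} \<in> E \<and> {x, w} \<in> E \<and> w \<noteq> d" if "x \<in> ?D' - ?D" for x
  proof -
    obtain d where d: "d \<in> ?D" "{x, d} \<in> E" using \<open>x \<in> ?D' - ?D\<close> by auto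
    obtain w where w: "w \<noteq> d" "{x, w} \<in> E" "{d, w} \<in> E" using tri[OF d(2)] by blast
    have "w \<in> ?D'" using w(3) d(1) EV(1)[OF w(3)] by (auto simp: insert_commute)
    then show ?thesis using d w by blast
  qed
  have eq: "3 * Suc k = 3 * k + 3" by simp
  show ?case unfolding eq
  proof (rule rainbow_extend[where E = E and c = c and n = "3 * k", OF fin _ EV(2) dom])
    show "?D \<subseteq> ?D'" by auto
    fix c' assume "\<And>e. e \<in> E \<Longrightarrow> e \<subseteq> ?D' \<Longrightarrow> c' e < 3 * k + 3"
      "\<And>x y. x \<in> ?D' \<Longrightarrow> y \<in> ?D' \<Longrightarrow> rainbow_reach ?D' E c' {..<3 * k + 3} x y"
    then show "\<exists>c. (\<forall>e\<in>E. e \<subseteq> ?D' \<longrightarrow> c e < 3 * k + 3) \<and>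
        (\<forall>x\<in>?D'. \<forall>y\<in>?D'. rainbow_reach ?D' E c {..<3 * k + 3} x y)"
      by (intro exI[of _ c'] conjI ballI impI)
  qed (use c in blast)+
qed

section \<open>Distance, radius and the upper bound\<close>

lemma graph_dist_le: "is_path V E u p v \<Longrightarrow> graph_dist V E u v \<le> length (path_edges p)"
  unfolding graph_dist_def by (rule Least_le) blast

lemma graph_dist_path:
  assumes "connected_graph V E" "u \<in> V" "v \<in> V"
  obtains p where "is_path V E u p v" "length (path_edges p) = graph_dist V E u v"
proof -
  have "\<exists>n p. is_path V E u p v \<and> length (path_edges p) = n"
    using assms by (auto simp: connected_graph_def)
  from LeastI_ex[OF this] show ?thesis using that unfolding graph_dist_def by blast
qed

lemma rad_center:
  assumes "finite V" "V \<noteq> {}"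
  obtains v where "v \<in> V" "rad V E = Max (graph_dist V E v ` V)"
proof -
  have "rad V E \<in> (\<lambda>v. Max ((\<lambda>x. graph_dist V E v x) ` V)) ` V"
    unfolding rad_def using assms by (intro Min_in) auto
  then show ?thesis using that by auto
qed

text \<open>The ball of radius \<open>rad V E\<close> around a centre is all of \<open>V\<close>.
  The colouring is kept apart from the bound on \<open>rc\<close> because its existence also shows
  that the least element in \<open>rc\<close> is attained.\<close>

lemma rainbow_colouring:
  assumes "simple_graph V E" "connected_graph V E" "bridgeless V E" "chordal V E"
  obtains c where "rainbow_connected V E c" "card (c ` E) \<le> 3 * rad V E"
proof -
  let ?r = "rad V E"
  have fin: "finite V" "V \<noteq> {}"
    using assms by (auto simp: simple_graph_def connected_graph_def)
  obtain v where v: "v \<in> V" and r: "?r = Max (graph_dist V E v ` V)"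
    using rad_center[OF fin] .
  define B where "B k = ball V E v k" for k
  have mono: "B m \<subseteq> B n" if "m \<le> n" for m n
    using that by (induction rule: dec_induct) (auto simp: B_def)
  have "x \<in> B ?r" if x: "x \<in> V" for x
  proof -
    obtain p where p: "is_path V E v p x" "length (path_edges p) = graph_dist V E v x"
      using graph_dist_path[OF assms(2) v x] .
    have "graph_dist V E v x \<le> ?r" unfolding r using fin x by simp
    then show ?thesis using path_end_in_ball[of v V E v 0 p x] p mono unfolding B_def by auto
  qed
  then have V: "ball V E v ?r = V" using ball_subset[OF v] unfolding B_def by blast
  have tri: "\<exists>w. w \<noteq> d \<and> {x, w} \<in> E \<and> {d, w} \<in> E" if "{x, d} \<in> E" for x d
    using edge_in_triangle[OF assms(1,3,4) that] by blast
  have "\<exists>c. (\<forall>e\<in>E. e \<subseteq> ball V E v ?r \<longrightarrow> c e < 3 * ?r) \<and>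
    (\<forall>x\<in>ball V E v ?r. \<forall>y\<in>ball V E v ?r. rainbow_reach (ball V E v ?r) E c {..<3 * ?r} x y)"
    by (rule rainbow_ball[OF assms(1) tri v])
  then obtain c where c: "\<forall>e\<in>E. e \<subseteq> V \<longrightarrow> c e < 3 * ?r"
    "\<forall>x\<in>V. \<forall>y\<in>V. rainbow_reach V E c {..<3 * ?r} x y"
    unfolding V by (elim exE conjE)
  have "c ` E \<subseteq> {..<3 * ?r}" using c(1) assms(1) by (auto simp: simple_graph_def)
  then have "card (c ` E) \<le> 3 * ?r" using card_mono[of "{..<3 * ?r}"] by fastforce
  moreover have "rainbow_connected V E c"
    using c(2) unfolding rainbow_connected_def rainbow_reach_def by blast
  ultimately show ?thesis using that by blast
qed

lemma rc_le_3_rad: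
  assumes "simple_graph V E" "connected_graph V E" "bridgeless V E" "chordal V E"
  shows "rc V E \<le> 3 * rad V E"
proof -
  obtain c where c: "rainbow_connected V E c" "card (c ` E) \<le> 3 * rad V E"
    using rainbow_colouring[OF assms] .
  have "rc V E \<le> card (c ` E)" unfolding rc_def by (rule Least_le) (use c in blast)
  then show ?thesis using c(2) by simp
qed

subsection \<open>Three triangles sharing a vertex\<close>

text \<open>The friendship graph with three triangles: hub \<open>0\<close> and blades
  \<open>{1, 2}\<close>, \<open>{3, 4}\<close>, \<open>{5, 6}\<close>. The odd vertices represent
  the blades.\<close>

definition windmill_vertices :: "nat set" where
  "windmill_vertices = {0, 1, 2, 3, 4, 5, 6}"

definition windmill_edges :: "nat set set" where
  "windmill_edges = {{0, 1}, {0, 2}, {0, 3}, {0, 4}, {0, 5}, {0, 6}, {1, 2}, {3, 4}, {5, 6}}"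

lemmas windmill_defs = windmill_vertices_def windmill_edges_def

lemma windmill_simple: "simple_graph windmill_vertices windmill_edges"
  by (auto simp: simple_graph_def windmill_defs)

lemma windmill_blade:
  assumes "u \<in> windmill_vertices" "u \<noteq> 0"
  shows "{u, 0} \<in> windmill_edges \<and> (\<exists>m\<in>windmill_vertices. m \<noteq> 0 \<and> m \<noteq> u \<and>
    {u, m} \<in> windmill_edges \<and> {m, 0} \<in> windmill_edges)"
  using assms unfolding windmill_vertices_def
  by (elim insertE) (simp_all add: windmill_edges_def doubleton_eq_iff)

text \<open>Each vertex other than the hub has two edge-disjoint routes to it, the spoke and the
  detour over its partner, and one deleted edge destroys at most one of them. As \<open>e\<close> is
  arbitrary, a non-edge gives connectedness of the whole graph.\<close>

lemma windmill_minus_edge_connected: "connected_graph windmill_vertices (windmill_edges - {e})"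
proof -
  let ?V = windmill_vertices and ?F = "windmill_edges - {e}"
  have st: "\<exists>q. is_path ?V ?F w q v" if "\<exists>p. is_path ?V ?F u p v" "w \<in> ?V" "{w, u} \<in> ?F" for u v w
    using is_path_step that by metis
  have hub: "\<exists>p. is_path ?V ?F u p v" if u: "u \<in> ?V" and p: "\<exists>p. is_path ?V ?F 0 p v" for u v
  proof -
    have "u = 0 \<or> {u, 0} \<in> ?F \<or> (\<exists>m\<in>?V. {u, m} \<in> ?F \<and> {m, 0} \<in> ?F)"
    proof (cases "u = 0 \<or> e \<noteq> {u, 0}")
      case True
      then show ?thesis using windmill_blade[OF u] by blast
    next
      case False
      then obtain m where "m \<in> ?V" "m \<noteq> 0" "m \<noteq> u" "{u, m} \<in> windmill_edges" "{m, 0} \<in> windmill_edges"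
        using windmill_blade[OF u] by blast
      then show ?thesis using False by (auto simp: doubleton_eq_iff)
    qed
    then show ?thesis using st p u by metis
  qed
  have "\<exists>p. is_path ?V ?F 0 p 0"
    by (rule exI, rule is_path_single) (simp add: windmill_defs)
  then have "\<exists>p. is_path ?V ?F 0 p v" if "v \<in> ?V" for v
    using hub[OF that] is_path_rev by metis
  then show ?thesis using hub unfolding connected_graph_def by (auto simp: windmill_defs)
qed

lemma windmill_bridgeless: "bridgeless windmill_vertices windmill_edges"
  using windmill_minus_edge_connected by (simp add: bridgeless_def bridge_def)

lemma windmill_connected: "connected_graph windmill_vertices windmill_edges"
proof -
  have "windmill_edges - {{}} = windmill_edges" by (auto simp: windmill_defs)
  then show ?thesis using windmill_minus_edge_connected[of "{}"] by simp
qed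

text \<open>On a cycle of length at least 4, vertices two steps apart are not consecutive, so an
  edge between them would be a chord.\<close>

lemma induced_cycle_no_short_chord:
  assumes "induced_cycle V E vs" "3 < length vs" "i < length vs"
  shows "{vs ! i, vs ! ((i + 2) mod length vs)} \<notin> E"
proof
  let ?n = "length vs" and ?e = "{vs ! i, vs ! ((i + 2) mod length vs)}"
  assume "?e \<in> E"
  have less: "(i + 2) mod ?n < ?n" "Suc j mod ?n < ?n" for j
    using assms(2) by (auto intro!: mod_less_divisor)
  then have "?e \<subseteq> set vs" using assms(3) by simp
  then have "?e \<in> cycle_edges vs"
    using assms(1) \<open>?e \<in> E\<close> unfolding induced_cycle_def by blast
  then obtain j where j: "j < ?n" "?e = {vs ! j, vs ! (Suc j mod ?n)}"
    unfolding cycle_edges_def by blast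
  have "distinct vs" using assms(1) by (simp add: induced_cycle_def is_cycle_def)
  \<comment> \<open>Equality of the two pairs would force \<open>1\<close> or \<open>3\<close> to be
    \<open>0\<close> modulo the length, which is impossible beyond length 3.\<close>
  then have "i = j \<and> (i + 2) mod ?n = Suc j mod ?n \<or> i = Suc j mod ?n \<and> (i + 2) mod ?n = j"
    using j less assms(3) by (auto simp: doubleton_eq_iff nth_eq_iff_index_eq)
  moreover have m: "k mod ?n = (if k < ?n then k else k - ?n)" if "k < 2 * ?n" for k
    using that by (simp add: mod_if)
  ultimately show False
    using assms(2,3) j(1) by (auto simp: m split: if_splits)
qed

text \<open>The hub is adjacent to every other vertex, so a long cycle through it has a chord to the
  vertex two steps on. A cycle avoiding the hub would contain two blade edges sharing a vertex, but
  these edges are pairwise disjoint.\<close>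

lemma windmill_chordal: "chordal windmill_vertices windmill_edges"
  unfolding chordal_def
proof
  let ?V = windmill_vertices and ?E = windmill_edges
  assume "\<exists>vs. induced_cycle ?V ?E vs \<and> 3 < length vs"
  then obtain vs where vs: "induced_cycle ?V ?E vs" "3 < length vs" by blast
  then have cyc: "distinct vs" "set vs \<subseteq> ?V" "cycle_edges vs \<subseteq> ?E"
    by (auto simp: induced_cycle_def is_cycle_def)
  show False
  proof (cases "0 \<in> set vs")
    case True
    then obtain i where i: "i < length vs" "vs ! i = 0" by (auto simp: in_set_conv_nth)
    let ?j = "(i + 2) mod length vs"
    have j: "?j < length vs" using vs(2) by (auto intro!: mod_less_divisor)
    have "?j \<noteq> i" using i(1) vs(2) by (auto simp: mod_if split: if_splits)
    then have "vs ! ?j \<noteq> 0" using cyc(1) i j nth_eq_iff_index_eq by metis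
    moreover have "vs ! ?j \<in> ?V" using cyc(2) j nth_mem by blast
    ultimately have "{vs ! ?j, 0} \<in> ?E" using windmill_blade by blast
    then show False using induced_cycle_no_short_chord[OF vs i(1)] i(2) by (simp add: insert_commute)
  next
    case False
    have "{vs ! 0, vs ! (Suc 0 mod length vs)} \<in> cycle_edges vs"
      "{vs ! 1, vs ! (Suc 1 mod length vs)} \<in> cycle_edges vs"
      unfolding cycle_edges_def using vs(2) by fastforce+
    then have "{vs ! 0, vs ! 1} \<in> ?E" "{vs ! 1, vs ! 2} \<in> ?E"
      using cyc(3) vs(2) by (auto simp: numeral_2_eq_2)
    moreover have len: "0 < length vs" "1 < length vs" "2 < length vs" using vs(2) by linarith+
    moreover from len have "vs ! 0 \<noteq> vs ! 2" using nth_eq_iff_index_eq[OF cyc(1)] by fastforce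
    moreover have "vs ! 0 \<noteq> 0" "vs ! 1 \<noteq> 0" "vs ! 2 \<noteq> 0"
      using False len[THEN nth_mem] by metis+
    ultimately show False by (auto simp: windmill_edges_def doubleton_eq_iff)
  qed
qed

section \<open>Radius and rainbow connection number of the windmill\<close>

lemma windmill_rad: "rad windmill_vertices windmill_edges = 1"
proof (rule antisym)
  let ?V = windmill_vertices and ?E = windmill_edges
  let ?ecc = "\<lambda>v. Max (graph_dist ?V ?E v ` ?V)"
  have fin: "finite ?V" "?V \<noteq> {}" by (auto simp: windmill_defs)
  have "graph_dist ?V ?E 0 x \<le> 1" if x: "x \<in> ?V" for x
  proof -
    have "\<exists>p. is_path ?V ?E 0 p x \<and> length (path_edges p) \<le> 1"
    proof (cases "x = 0")
      case True
      then show ?thesis by (intro exI[of _ "[0]"]) (simp add: is_path_def windmill_defs)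
    next
      case False
      moreover have "0 \<in> ?V" by (simp add: windmill_vertices_def)
      ultimately show ?thesis using False x windmill_blade[OF x False]
        by (intro exI[of _ "[0, x]"]) (auto simp: is_path_def insert_commute)
    qed
    then obtain p where p: "is_path ?V ?E 0 p x" "length (path_edges p) \<le> 1" by (elim exE conjE)
    show ?thesis using graph_dist_le[OF p(1)] p(2) by linarith
  qed
  then have "?ecc 0 \<le> 1" using fin by simp
  moreover have "?ecc 0 \<in> ?ecc ` ?V" by (rule imageI) (simp add: windmill_vertices_def)
  then have "rad ?V ?E \<le> ?ecc 0" unfolding rad_def by (rule Min_le[rotated]) (simp add: fin)
  ultimately show "rad ?V ?E \<le> 1" by simp
  obtain v where v: "v \<in> ?V" "rad ?V ?E = ?ecc v" using rad_center[OF fin] .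
  \<comment> \<open>Every vertex has another vertex at positive distance, so no eccentricity is
    0.\<close>
  have "0 \<in> ?V" "1 \<in> ?V" by (simp_all add: windmill_vertices_def)
  then obtain x where x: "x \<in> ?V" "x \<noteq> v" by (metis zero_neq_one)
  obtain p where p: "is_path ?V ?E v p x" "length (path_edges p) = graph_dist ?V ?E v x"
    using graph_dist_path[OF windmill_connected v(1) x(1)] .
  have "graph_dist ?V ?E v x \<noteq> 0"
  proof
    assume "graph_dist ?V ?E v x = 0"
    then have "length p \<le> 1" using p(2) by (simp add: length_path_edges)
    then show False using p(1) x(2) by (cases p) (auto simp: is_path_def)
  qed
  moreover have "graph_dist ?V ?E v x \<le> ?ecc v" using fin x by simp
  ultimately show "1 \<le> rad ?V ?E" using v by simp
qed

text \<open>Hence different odd vertices are not adjacent and have only the hub as common neighbour,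
  which pins down the short paths between blades.\<close>

lemma windmill_odd_neighbours:
  assumes "a \<in> {1, 3, 5}" "{a, y} \<in> windmill_edges"
  shows "y = 0 \<or> y = Suc a"
  using assms by (elim insertE) (auto simp: windmill_edges_def doubleton_eq_iff)

text \<open>With at most two colours a rainbow path between two blades is the path of length two
  through the hub, so the three spokes to \<open>1\<close>, \<open>3\<close>, \<open>5\<close> would need different colours.\<close>

lemma windmill_colours:
  assumes "rainbow_connected windmill_vertices windmill_edges c"
  shows "3 \<le> card (c ` windmill_edges)"
proof (rule ccontr)
  let ?V = windmill_vertices and ?E = windmill_edges
  assume few: "\<not> 3 \<le> card (c ` ?E)"
  have finE: "finite ?E" by (simp add: windmill_edges_def)
  have ne: "c {0, a} \<noteq> c {0, b}" if ab: "a \<in> {1, 3, 5}" "b \<in> {1, 3, 5}" "a \<noteq> b" for a b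
  proof -
    have "a \<in> ?V" "b \<in> ?V" using ab by (auto simp: windmill_defs)
    then obtain p where p: "is_path ?V ?E a p b" "distinct (map c (path_edges p))"
      using assms unfolding rainbow_connected_def by blast
    \<comment> \<open>A rainbow path has at most as many edges as there are colours, here at most
      two.\<close>
    have "length (path_edges p) = card (c ` set (path_edges p))"
      using distinct_card[OF p(2)] by simp
    also have "\<dots> \<le> card (c ` ?E)"
      using p(1) finE by (intro card_mono) (auto simp: is_path_def)
    finally have "length p \<le> 3" using few by (simp add: length_path_edges)
    then consider "p = []" | x where "p = [x]" | x y where "p = [x, y]" | x y z where "p = [x, y, z]"
      by (cases p rule: remdups_adj.cases; cases "tl (tl p)"; cases "tl (tl (tl p))") auto
    then show ?thesis
    proof cases
      case (4 x y z)
      then have e: "x = a" "z = b" "{a, y} \<in> ?E" "{y, b} \<in> ?E" "c {a, y} \<noteq> c {y, b}"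
        using p by (auto simp: is_path_def)
      moreover have "y = 0"
        using windmill_odd_neighbours[OF ab(1) e(3)] windmill_odd_neighbours[OF ab(2), of y] e(4) ab(3)
        by (auto simp: insert_commute)
      ultimately show ?thesis by (simp add: insert_commute)
    next
      case (3 x y)
      then have "{a, b} \<in> ?E" using p by (auto simp: is_path_def)
      then show ?thesis using windmill_odd_neighbours[OF ab(1)] ab(1,2) by fastforce
    qed (use p ab(3) in \<open>auto simp: is_path_def\<close>)
  qed
  have "card {c {0, 1}, c {0, 3}, c {0, 5}} = 3"
    using ne[of 1 3] ne[of 1 5] ne[of 3 5] by simp
  moreover have "card {c {0, 1}, c {0, 3}, c {0, 5}} \<le> card (c ` ?E)"
    using finE by (intro card_mono) (auto simp: windmill_edges_def)
  ultimately show False using few by simp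
qed

lemma windmill_rc: "rc windmill_vertices windmill_edges = 3"
proof (rule antisym)
  let ?V = windmill_vertices and ?E = windmill_edges
  note graph = windmill_simple windmill_connected windmill_bridgeless windmill_chordal
  show "rc ?V ?E \<le> 3" using rc_le_3_rad[OF graph] windmill_rad by simp
  \<comment> \<open>Some rainbow colouring exists, so the least element is attained and the bound
    for all rainbow colourings passes to \<open>rc\<close>.\<close>
  have "\<exists>k c. rainbow_connected ?V ?E c \<and> card (c ` ?E) = k"
    using rainbow_colouring[OF graph] by metis
  from LeastI_ex[OF this] show "3 \<le> rc ?V ?E"
    unfolding rc_def using windmill_colours by metis
qed

text \<open>The condition \<open>0 < rad V E\<close> rules out the one-vertex graph, for which
  equality holds trivially with both sides \<open>0\<close>.\<close>

theorem theorem3: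
  "(\<forall>(V :: 'a set) E. simple_graph V E \<and> connected_graph V E \<and> bridgeless V E \<and> chordal V E
      \<longrightarrow> rc V E \<le> 3 * rad V E) \<and>
   (\<exists>(V :: nat set) E. simple_graph V E \<and> connected_graph V E \<and> bridgeless V E \<and> chordal V E \<and>
      0 < rad V E \<and> rc V E = 3 * rad V E)"
proof (intro conjI allI impI)
  show "rc V E \<le> 3 * rad V E"
    if "simple_graph V E \<and> connected_graph V E \<and> bridgeless V E \<and> chordal V E"
    for V :: "'a set" and E
    using rc_le_3_rad that by blast
  show "\<exists>(V :: nat set) E. simple_graph V E \<and> connected_graph V E \<and> bridgeless V E \<and> chordal V E \<and>
      0 < rad V E \<and> rc V E = 3 * rad V E"
    using windmill_simple windmill_connected windmill_bridgeless windmill_chordal windmill_rad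
      windmill_rc
    by (intro exI[of _ windmill_vertices] exI[of _ windmill_edges]) simp
qed

end
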